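(* Let $\mathcal{A}$ and $\mathcal{B}$ be two complex unital Banach algebras and let $\mathcal{T}\colon\mathcal{A}\to\mathcal{B}$ be a (not necessarily continuous) algebra homomorphism. Let $\lambda\in\mathbb{C}$, $a\in\mathcal{A}$ and $b\in\mathcal{B}$ be such that $\mathcal{T}(a)=b$. Then the following statements hold. (i) Suppose that there exists an idempotent $p\in\mathcal{A}$, $p\notin N(\mathcal{T})$, such that, with $q=\mathcal{T}(p)$, $p'=1-p$, $q'=1-q$: $p(a-\lambda)(1-p)\in N(\mathcal{T})$ and $(1-p)(a-\lambda)p\in N(\mathcal{T})$, $(1-p)(a-\lambda)(1-p)\in\Phi_{\mathcal{T}_{p',q'}}(p'\mathcal{A}p')$, and $p(a-\lambda)p\in\mathscr{R}_{\mathcal{T}}(\mathcal{A})$ (respectively $p(a-\lambda)p\in\mathscr{N}_{\mathcal{T}}(\mathcal{A})$; respectively $p(a-\lambda)p\in\mathscr{R}_{\mathcal{T}}(\mathcal{A})\setminus\mathscr{N}_{\mathcal{T}}(\mathcal{A})$). Then $\lambda\in\mathrm{iso}\,\sigma(b)$ (respectively $\lambda\in\Pi(b)$; respectively $\lambda\in I(b)$). In particular, $0\neq q=\mathcal{T}(p)$ is the spectral idempotent of $b$ corresponding to $\lambda$. (ii) Let $\lambda\in\mathrm{iso}\,\sigma(b)$ (respectively $\lambda\in\Pi(b)$; respectively $\lambda\in I(b)$) and let $0\neq q\in\mathcal{B}$ be the spectral idempotent of $b$ corresponding to $\lambda$. If there exists an idempotent $p\in\mathcal{A}$ such that $\mathcal{T}(p)=q$,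 then, with $p'=1-p$ and $q'=1-q$: $p\notin N(\mathcal{T})$, $p(a-\lambda)(1-p)\in N(\mathcal{T})$ and $(1-p)(a-\lambda)p\in N(\mathcal{T})$, $(1-p)(a-\lambda)(1-p)\in\Phi_{\mathcal{T}_{p',q'}}(p'\mathcal{A}p')$, and $p(a-\lambda)p\in\mathscr{R}_{\mathcal{T}}(\mathcal{A})$ (respectively $p(a-\lambda)p\in\mathscr{N}_{\mathcal{T}}(\mathcal{A})$; respectively $p(a-\lambda)p\in\mathscr{R}_{\mathcal{T}}(\mathcal{A})\setminus\mathscr{N}_{\mathcal{T}}(\mathcal{A})$).
   Context: Algebra homomorphisms between unital Banach algebras are unital ($\mathcal{T}(1)=1$) and need not be continuous; $N(\mathcal{T})$ is the kernel. For a scalar $\lambda$, $a-\lambda$ means $a-\lambda 1$. For an idempotent $e\ne 0$ of a unital Banach algebra $\mathcal{D}$, $e\mathcal{D}e$ is a unital Banach algebra with unit $e$ (if $e=0$ it is the zero algebra, in which $0$ is regarded as invertible). For $p\in\mathcal{A}$ idempotent and $q=\mathcal{T}(p)$, put $p'=1-p$, $q'=1-q$, and let $\mathcal{T}_{p',q'}\colon p'\mathcal{A}p'\to q'\mathcal{B}q'$ be the restriction of $\mathcal{T}$. $\Phi_{\mathcal{T}_{p',q'}}(p'\mathcal{A}p')=\{x\in p'\mathcal{A}p'\colon \mathcal{T}(x)\text{ is invertible in } q'\mathcal{B}q'\}$ (Fredholm elements relative to $\mathcal{T}_{p',q'}$). $\mathscr{R}_{\mathcal{T}}(\mathcal{A})=\{x\in\mathcal{A}\colon\mathcal{T}(x)\text{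 is quasi-nilpotent in }\mathcal{B}\}$ (Riesz elements relative to $\mathcal{T}$). $\mathscr{N}_{\mathcal{T}}(\mathcal{A})=\{x\in\mathcal{A}\colon \exists k\in\mathbb{N},\ k\ge1,\ x^k\in N(\mathcal{T})\}$ ($\mathcal{T}$-nilpotent elements). For $b\in\mathcal{B}$: $\sigma(b)$ is the spectrum; $\mathrm{iso}\,\sigma(b)$ is the set of isolated points of $\sigma(b)$; $\Pi(b)\subseteq\mathrm{iso}\,\sigma(b)$ is the set of poles of the resolvent function $\mu\mapsto(\mu-b)^{-1}$, i.e. those isolated points $\lambda_0$ for which the Laurent expansion of the resolvent around $\lambda_0$ has a nonzero singular part with only finitely many nonzero coefficients; $I(b)=\mathrm{iso}\,\sigma(b)\setminus\Pi(b)$. For $\lambda\in\mathrm{iso}\,\sigma(b)$, the spectral idempotent of $b$ corresponding to $\lambda$ is the idempotent $0\neq q=q^2\in\mathcal{B}$ such that $bq=qb$, $(b-\lambda)q$ is quasi-nilpotent and $b-\lambda+q$ is invertible in $\mathcal{B}$. *)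

theory Defs
  imports "HOL-Analysis.Analysis"
begin

text \<open>
  The library has real but no complex normed algebras. The underlying real structure is tied
  to the complex scalar multiplication by \<open>scaleR_scaleC\<close>. The sort
  \<open>{real_algebra_1, real_normed_algebra}\<close> is used instead of \<open>real_normed_algebra_1\<close> because
  the latter demands \<open>norm 1 = 1\<close>, which is not part of the notion of a unital Banach algebra
  used here: the corner algebra of an idempotent \<open>e\<close> must be one, and \<open>norm e\<close> can exceed 1.
\<close>

class complex_banach_algebra_1 = real_algebra_1 + real_normed_algebra + banach +
  fixes scaleC :: "complex \<Rightarrow> 'a \<Rightarrow> 'a" (infixr "*\<^sub>C" 75)
  assumes scaleC_add_right: "c *\<^sub>C (x + y) = c *\<^sub>C x + c *\<^sub>C y"
    and scaleC_add_left: "(c + d) *\<^sub>C x = c *\<^sub>C x + d *\<^sub>C x"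
    and scaleC_scaleC: "c *\<^sub>C (d *\<^sub>C x) = (c * d) *\<^sub>C x"
    and scaleR_scaleC: "scaleR r x = complex_of_real r *\<^sub>C x"
    and mult_scaleC_left: "(c *\<^sub>C x) * y = c *\<^sub>C (x * y)"
    and mult_scaleC_right: "x * (c *\<^sub>C y) = c *\<^sub>C (x * y)"
    and norm_scaleC: "norm (c *\<^sub>C x) = cmod c * norm x"

instantiation complex :: complex_banach_algebra_1
begin

definition scaleC_complex :: "complex \<Rightarrow> complex \<Rightarrow> complex" where
  "scaleC_complex c x = c * x"

instance
  by standard (simp_all add: scaleC_complex_def algebra_simps norm_mult scaleR_conv_of_real)

end

definition of_complex :: "complex \<Rightarrow> 'a::complex_banach_algebra_1" where
  "of_complex c = c *\<^sub>C 1"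

definition algebra_hom ::
  "('a::complex_banach_algebra_1 \<Rightarrow> 'b::complex_banach_algebra_1) \<Rightarrow> bool" where
  "algebra_hom T \<longleftrightarrow>
     (\<forall>x y. T (x + y) = T x + T y) \<and>
     (\<forall>c x. T (c *\<^sub>C x) = c *\<^sub>C T x) \<and>
     (\<forall>x y. T (x * y) = T x * T y) \<and>
     T 1 = 1"

definition hom_ker :: "('a \<Rightarrow> 'b::zero) \<Rightarrow> 'a set" where
  "hom_ker T = {x. T x = 0}"

definition idem :: "'a::times \<Rightarrow> bool" where
  "idem e \<longleftrightarrow> e * e = e"

definition corner :: "'a::times \<Rightarrow> 'a set" where
  "corner e = {e * x * e | x. True}"

text \<open>For \<open>e = 0\<close> the corner is \<open>{0}\<close> and \<open>0\<close> is invertible in it.\<close>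

definition invertible_in_corner :: "'a::times \<Rightarrow> 'a \<Rightarrow> bool" where
  "invertible_in_corner e x \<longleftrightarrow> x \<in> corner e \<and> (\<exists>y\<in>corner e. x * y = e \<and> y * x = e)"

definition invertible_elt :: "'a::monoid_mult \<Rightarrow> bool" where
  "invertible_elt x \<longleftrightarrow> (\<exists>y. x * y = 1 \<and> y * x = 1)"

definition spectrum :: "'a::complex_banach_algebra_1 \<Rightarrow> complex set" where
  "spectrum b = {\<mu>. \<not> invertible_elt (of_complex \<mu> - b)}"

definition quasinilpotent :: "'a::complex_banach_algebra_1 \<Rightarrow> bool" where
  "quasinilpotent x \<longleftrightarrow> spectrum x = {0}"

definition iso_spectrum :: "'a::complex_banach_algebra_1 \<Rightarrow> complex set" where
  "iso_spectrum b = {\<mu>. \<mu> isolated_in spectrum b}"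

text \<open>Only meaningful for \<open>\<mu>\<close> outside the spectrum of \<open>b\<close>.\<close>

definition resolvent :: "'a::complex_banach_algebra_1 \<Rightarrow> complex \<Rightarrow> 'a" where
  "resolvent b \<mu> = (THE y. (of_complex \<mu> - b) * y = 1 \<and> y * (of_complex \<mu> - b) = 1)"

text \<open>\<open>c n\<close> is the coefficient of \<open>(\<mu> - z) powi n\<close>; the expansion is required on some punctured disc
  around \<open>z\<close>.\<close>

definition laurent_expansion_at ::
  "(complex \<Rightarrow> 'a::complex_banach_algebra_1) \<Rightarrow> (int \<Rightarrow> 'a) \<Rightarrow> complex \<Rightarrow> bool" where
  "laurent_expansion_at f c z \<longleftrightarrow>
     (\<exists>r>0. \<forall>\<mu>. 0 < cmod (\<mu> - z) \<and> cmod (\<mu> - z) < r \<longrightarrow>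
        ((\<lambda>n. ((\<mu> - z) powi n) *\<^sub>C c n) has_sum f \<mu>) UNIV)"

definition poles :: "'a::complex_banach_algebra_1 \<Rightarrow> complex set" where
  "poles b = {\<mu> \<in> iso_spectrum b. \<exists>c. laurent_expansion_at (resolvent b) c \<mu> \<and>
     {n. n < 0 \<and> c n \<noteq> 0} \<noteq> {} \<and> finite {n. n < 0 \<and> c n \<noteq> 0}}"

definition nonpoles :: "'a::complex_banach_algebra_1 \<Rightarrow> complex set" where
  "nonpoles b = iso_spectrum b - poles b"

definition spectral_idempotent ::
  "'a::complex_banach_algebra_1 \<Rightarrow> complex \<Rightarrow> 'a \<Rightarrow> bool" where
  "spectral_idempotent b \<mu> q \<longleftrightarrow>
     q \<noteq> 0 \<and> idem q \<and> b * q = q * b \<and>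
     quasinilpotent ((b - of_complex \<mu>) * q) \<and>
     invertible_elt (b - of_complex \<mu> + q)"

text \<open>The Fredholm elements of the corner at \<open>p'\<close> relative to the restriction of \<open>T\<close> to a map
  from the corner at \<open>p'\<close> to the corner at \<open>q'\<close>, where \<open>T p' = q'\<close>.\<close>

definition fredholm_corner ::
  "('a::complex_banach_algebra_1 \<Rightarrow> 'b::complex_banach_algebra_1) \<Rightarrow> 'a \<Rightarrow> 'b \<Rightarrow> 'a set" where
  "fredholm_corner T p' q' = {x \<in> corner p'. invertible_in_corner q' (T x)}"

definition riesz_elts ::
  "('a::complex_banach_algebra_1 \<Rightarrow> 'b::complex_banach_algebra_1) \<Rightarrow> 'a set" where
  "riesz_elts T = {x. quasinilpotent (T x)}"

definition nilpotent_elts ::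
  "('a::complex_banach_algebra_1 \<Rightarrow> 'b::complex_banach_algebra_1) \<Rightarrow> 'a set" where
  "nilpotent_elts T = {x. \<exists>k\<ge>1. x ^ k \<in> hom_ker T}"

end

theory Submission
  imports Defs
begin

text \<open>
  Write \<open>c = b - \<mu>\<close> and \<open>q = T p\<close>. Applying \<open>T\<close> turns the hypotheses on the four blocks of \<open>a - \<mu>\<close>
  into hypotheses on the blocks of \<open>c\<close> with respect to \<open>q\<close>: the off-diagonal blocks vanish, which
  means \<open>c q = q c\<close>; the block \<open>x = c q\<close> is quasi-nilpotent; and the block at \<open>1 - q\<close> is invertible
  in its corner. This is a reformulation of \<open>q\<close> being the spectral idempotent of \<open>b\<close> at \<open>\<mu>\<close>
  (\<open>spectral_idempotent_iff_blocks\<close>). It remains to show, for a spectral idempotent \<open>q\<close>, that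
  \<open>\<mu>\<close> is an isolated point of the spectrum, and that it is a pole exactly when \<open>x\<close> is nilpotent.

  Let \<open>y\<close> be the inverse of \<open>c\<close> in the corner at \<open>1 - q\<close>. For small \<open>w \<noteq> 0\<close> the resolvent of \<open>b\<close> at
  \<open>\<mu> + w\<close> is \<open>(w - x)\<^sup>-\<^sup>1 q - (\<Sum>n. w\<^sup>n y\<^sup>n\<^sup>+\<^sup>1)\<close> (\<open>resolvent_shift\<close>), so that \<open>\<mu>\<close> is at most an isolated
  point of the spectrum. If \<open>x\<^sup>k = 0\<close>, then \<open>(w - x)\<^sup>-\<^sup>1\<close> is the finite sum of the \<open>x\<^sup>j / w\<^sup>j\<^sup>+\<^sup>1\<close> and \<open>\<mu>\<close> is a
  pole.

  The two remaining points, that \<open>\<mu>\<close> does lie in the spectrum and that a pole forces \<open>x\<close> to be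
  nilpotent, are analytic. Instead of vector-valued complex function theory the proof uses
  Rickart's average over roots of unity: if \<open>\<omega>\<close> runs through the \<open>m\<close>-th roots of unity, the mean of
  the elements \<open>(1 - \<omega> z x)\<^sup>-\<^sup>1\<close> is \<open>(1 - z\<^sup>m x\<^sup>m)\<^sup>-\<^sup>1\<close> (\<open>roots_of_unity_average\<close>). With the uniform
  continuity of \<open>z \<mapsto> (1 - z x)\<^sup>-\<^sup>1\<close> on discs it gives \<open>t\<^sup>m \<parallel>x\<^sup>m\<parallel> \<longlonglongrightarrow> 0\<close> for every \<open>t\<close> when \<open>x\<close> is
  quasi-nilpotent. If \<open>c\<close> had a left inverse \<open>v\<close>, then \<open>q = v\<^sup>n x\<^sup>n q\<close> would tend to \<open>0\<close>, so \<open>q = 0\<close>. At a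
  pole, \<open>x\<^sup>N (w - x)\<^sup>-\<^sup>1\<close> is bounded near \<open>w = 0\<close> for some \<open>N\<close>, and averaging over circles gives
  \<open>\<parallel>x\<^sup>N\<parallel> = O(\<bar>w\<bar>)\<close>, hence \<open>x\<^sup>N = 0\<close>.
\<close>

section \<open>Complex scalars\<close>

interpretation scaleC: vector_space "scaleC :: complex \<Rightarrow> 'a \<Rightarrow> 'a::complex_banach_algebra_1"
proof
  show "1 *\<^sub>C x = x" for x :: 'a
    using scaleR_scaleC[of 1 x] by simp
qed (simp_all add: scaleC_add_right scaleC_add_left scaleC_scaleC)

lemma of_complex_mult_left [simp]: "of_complex c * x = c *\<^sub>C x"
  by (simp add: of_complex_def mult_scaleC_left)

lemma of_complex_mult_right [simp]: "x * of_complex c = c *\<^sub>C x"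
  by (simp add: of_complex_def mult_scaleC_right)

lemma of_complex_add: "of_complex (c + d) = of_complex c + of_complex d"
  by (simp add: of_complex_def scaleC_add_left)

lemma scaleC_power: "(c *\<^sub>C x) ^ n = c ^ n *\<^sub>C x ^ n"
  by (induction n) (simp_all add: mult_scaleC_left mult_scaleC_right)

section \<open>Averages over roots of unity\<close>

lemma cis_two_pi_div_power:
  assumes "m > 0"
  shows "cis (2 * pi / real m) ^ m = 1"
proof -
  have "cis (2 * pi / real m) ^ m = cis (real m * (2 * pi / real m))"
    by (rule Complex.DeMoivre)
  also have "real m * (2 * pi / real m) = 2 * pi"
    using assms by simp
  finally show ?thesis by (simp add: complex_eq_iff)
qed

lemma root_of_unity_power_sum:
  fixes m k :: nat
  assumes "k < m"
  shows "(\<Sum>j<m. (cis (2 * pi / m) ^ j) ^ k) = (if k = 0 then of_nat m else 0)"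
proof (cases "k = 0")
  case False
  define u where "u = cis (2 * pi / m) ^ k"
  have "u ^ m = (cis (2 * pi / m) ^ m) ^ k"
    by (simp add: u_def power_mult [symmetric] mult.commute)
  also have "cis (2 * pi / m) ^ m = 1"
    using assms by (intro cis_two_pi_div_power) simp
  finally have "u ^ m = 1" by simp
  have "u = exp (2 * of_real pi * \<i> * (of_nat k / of_nat m))"
    unfolding u_def by (subst Complex.DeMoivre) (simp add: cis_conv_exp mult_ac)
  then have "u \<noteq> 1"
    using complex_root_unity_eq_1[of m k] assms False by (auto dest: dvd_imp_le)
  have "(\<Sum>j<m. (cis (2 * pi / m) ^ j) ^ k) = (\<Sum>j<m. u ^ j)"
    by (simp add: u_def power_mult [symmetric] mult.commute)
  also have "\<dots> = 0"
    using \<open>u \<noteq> 1\<close> \<open>u ^ m = 1\<close> by (simp add: geometric_sum)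
  finally show ?thesis using False by simp
qed simp

lemma one_minus_power_eq:
  fixes y :: "'a::ring_1"
  shows "1 - y ^ m = (1 - y) * (\<Sum>k<m. y ^ k)"
  by (induction m) (simp_all add: algebra_simps)

text \<open>
  Only left inverses of the elements \<open>1 - \<omega> y\<close> are needed. Each of them, multiplied by
  \<open>1 - y\<^sup>m = 1 - (\<omega> y)\<^sup>m\<close>, becomes the geometric sum of the \<open>(\<omega> y)\<^sup>k\<close> with \<open>k < m\<close>, and the sum over
  \<open>\<omega>\<close> kills every term but the one with \<open>k = 0\<close>.
\<close>

lemma roots_of_unity_average:
  fixes y :: "'a::complex_banach_algebra_1"
  assumes m: "m > 0"
    and r: "\<And>j. j < m \<Longrightarrow> r j * (1 - cis (2 * pi / real m) ^ j *\<^sub>C y) = 1"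
  shows "((1 / of_nat m) *\<^sub>C (\<Sum>j<m. r j)) * (1 - y ^ m) = 1"
proof -
  let ?w = "cis (2 * pi / real m)"
  have w1: "?w ^ m = 1"
    using m by (rule cis_two_pi_div_power)
  have rj: "r j * (1 - y ^ m) = (\<Sum>k<m. (?w ^ j) ^ k *\<^sub>C y ^ k)" if "j < m" for j
  proof -
    have "y ^ m = (?w ^ j *\<^sub>C y) ^ m"
      by (simp add: scaleC_power power_mult [symmetric] mult.commute[of j])
        (simp add: power_mult w1)
    then have "1 - y ^ m = (1 - ?w ^ j *\<^sub>C y) * (\<Sum>k<m. (?w ^ j *\<^sub>C y) ^ k)"
      by (simp only: one_minus_power_eq)
    then have "r j * (1 - y ^ m) = (\<Sum>k<m. (?w ^ j *\<^sub>C y) ^ k)"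
      using r[OF that] by (simp add: mult.assoc [symmetric])
    then show ?thesis by (simp add: scaleC_power)
  qed
  have "(\<Sum>j<m. r j) * (1 - y ^ m) = (\<Sum>j<m. \<Sum>k<m. (?w ^ j) ^ k *\<^sub>C y ^ k)"
    by (simp add: sum_distrib_right rj)
  also have "\<dots> = (\<Sum>k<m. (\<Sum>j<m. (?w ^ j) ^ k) *\<^sub>C y ^ k)"
    by (subst sum.swap) (simp add: scaleC.scale_sum_left)
  also have "\<dots> = (\<Sum>k<m. (if k = 0 then of_nat m *\<^sub>C 1 else 0))"
    by (intro sum.cong) (auto simp: root_of_unity_power_sum)
  also have "\<dots> = of_nat m *\<^sub>C 1"
    using m by simp
  finally show ?thesis
    using m by (simp add: mult_scaleC_left)
qed

lemma continuous_on_inverse_pencil: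
  fixes x :: "'a::complex_banach_algebra_1"
  assumes L: "\<And>z. R z * (1 - z *\<^sub>C x) = 1" and Rr: "\<And>z. (1 - z *\<^sub>C x) * R z = 1"
  shows "continuous_on A R"
proof -
  have "isCont R z0" for z0
  proof -
    have diff: "R z - R z0 = (z - z0) *\<^sub>C (R z * (x * R z0))" for z
    proof -
      have "R z - R z0 = R z * ((1 - z0 *\<^sub>C x) * R z0) - (R z * (1 - z *\<^sub>C x)) * R z0"
        by (simp add: L Rr)
      then show ?thesis
        by (simp add: mult_scaleC_left mult_scaleC_right scaleC.scale_left_diff_distrib
            scaleC.scale_right_diff_distrib right_diff_distrib left_diff_distrib mult.assoc)
    qed
    define K where "K = norm (x * R z0)"
    have K0: "K \<ge> 0" by (simp add: K_def)
    have nd: "norm (R z - R z0) \<le> cmod (z - z0) * K * norm (R z)" for z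
      unfolding diff K_def norm_scaleC
      using norm_mult_ineq[of "R z" "x * R z0"] mult_left_mono[OF _ norm_ge_zero[of "z - z0"]]
      by (metis mult.assoc mult.commute)
    define d where "d = 1 / (2 * (K + 1))"
    have d0: "d > 0" using K0 by (simp add: d_def)
    have bd: "norm (R z) \<le> 2 * norm (R z0)" if "cmod (z - z0) < d" for z
    proof -
      have "cmod (z - z0) * K \<le> d * (K + 1)"
        using that K0 d0 by (intro mult_mono) auto
      also have "\<dots> = 1 / 2" using K0 by (simp add: d_def field_simps)
      finally have "cmod (z - z0) * K * norm (R z) \<le> 1 / 2 * norm (R z)"
        by (intro mult_right_mono) auto
      then show ?thesis
        using nd[of z] norm_triangle_ineq2[of "R z" "R z0"] by linarith
    qed
    have "(R \<longlongrightarrow> R z0) (at z0)"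
    proof (rule LIM_zero_cancel, rule Lim_null_comparison)
      show "\<forall>\<^sub>F z in at z0. norm (R z - R z0) \<le> cmod (z - z0) * K * (2 * norm (R z0))"
        unfolding eventually_at
      proof (intro exI[of _ d] conjI ballI impI d0)
        fix z assume "z \<noteq> z0 \<and> dist z z0 < d"
        then show "norm (R z - R z0) \<le> cmod (z - z0) * K * (2 * norm (R z0))"
          using nd[of z] bd[of z] K0
          by (smt (verit, best) dist_norm mult_left_mono mult_nonneg_nonneg norm_ge_zero)
      qed
      show "((\<lambda>z. cmod (z - z0) * K * (2 * norm (R z0))) \<longlongrightarrow> 0) (at z0)"
        by (auto intro!: tendsto_eq_intros)
    qed
    then show ?thesis by (simp add: isCont_def)
  qed
  then show ?thesis by (simp add: continuous_at_imp_continuous_on)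
qed

text \<open>
  Let \<open>P t\<close> say that \<open>t\<^sup>n \<parallel>x\<^sup>n\<parallel> \<longlonglongrightarrow> 0\<close>, and let \<open>F n z\<close> be the average of \<open>R\<close> over the points \<open>\<omega> z\<close>
  with \<open>\<omega>\<^sup>n = 1\<close>; it is a left inverse of \<open>1 - z\<^sup>n x\<^sup>n\<close>. Clearly \<open>P 0\<close>. If \<open>P t\<close> holds, then \<open>F n t\<close> is
  close to \<open>1\<close> for large \<open>n\<close>. As the functions \<open>F n\<close> inherit the modulus of uniform continuity of
  \<open>R\<close>, also \<open>F n s\<close> is close to \<open>1\<close> for \<open>s\<close> slightly larger than \<open>t\<close>. This bounds \<open>s\<^sup>n \<parallel>x\<^sup>n\<parallel>\<close>, so that \<open>P\<close>
  holds below \<open>s\<close>. The step size is uniform, so finitely many steps reach \<open>t0\<close>.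
\<close>

lemma power_decay_if_pencil_invertible:
  fixes x :: "'a::complex_banach_algebra_1"
  assumes L: "\<And>z. R z * (1 - z *\<^sub>C x) = 1" and Rr: "\<And>z. (1 - z *\<^sub>C x) * R z = 1"
    and t0: "t0 \<ge> 0"
  shows "(\<lambda>n. t0 ^ n * norm (x ^ n)) \<longlonglongrightarrow> 0"
proof -
  define P where "P t \<longleftrightarrow> (\<lambda>n. t ^ n * norm (x ^ n)) \<longlonglongrightarrow> 0" for t :: real
  define F where "F n z = (1 / of_nat n) *\<^sub>C (\<Sum>j<n. R (cis (2 * pi / real n) ^ j * z))"
    for n :: nat and z
  have F: "F n z * (1 - z ^ n *\<^sub>C x ^ n) = 1" if "n > 0" for n z
    unfolding F_def scaleC_power [symmetric]
    by (rule roots_of_unity_average[OF that]) (simp add: scaleC_scaleC L)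
  have "uniformly_continuous_on (cball 0 (t0 + 1)) R"
    by (intro compact_uniformly_continuous continuous_on_inverse_pencil[of R x] L Rr) auto
  then obtain d0 where d0: "d0 > 0"
    and "\<And>z z'. \<lbrakk>z \<in> cball 0 (t0 + 1); z' \<in> cball 0 (t0 + 1); dist z' z < d0\<rbrakk>
          \<Longrightarrow> dist (R z') (R z) < 1 / 4"
    unfolding uniformly_continuous_on_def by (metis zero_less_divide_1_iff zero_less_numeral)
  then have d0R: "norm (R z' - R z) \<le> 1 / 4"
    if "cmod z \<le> t0 + 1" "cmod z' \<le> t0 + 1" "cmod (z' - z) < d0" for z z'
    using that by (fastforce simp: dist_norm)
  define d where "d = min 1 d0"
  have d: "d > 0" "d \<le> 1" "d \<le> d0" using d0 by (auto simp: d_def)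
  have Fdiff: "norm (F n z' - F n z) \<le> 1 / 4"
    if "n > 0" "cmod z \<le> t0 + 1" "cmod z' \<le> t0 + 1" "cmod (z' - z) < d0" for n z z'
  proof -
    let ?w = "\<lambda>j. cis (2 * pi / real n) ^ j"
    have "F n z' - F n z = (1 / of_nat n) *\<^sub>C (\<Sum>j<n. R (?w j * z') - R (?w j * z))"
      by (simp add: F_def scaleC.scale_right_diff_distrib sum_subtractf)
    also have "norm \<dots> \<le> 1 / real n * (\<Sum>j<n. 1 / 4)"
      unfolding norm_scaleC
    proof (intro mult_mono)
      show "norm (\<Sum>j<n. R (?w j * z') - R (?w j * z)) \<le> (\<Sum>j<n. 1 / 4)"
      proof (intro sum_norm_le d0R)
        fix j
        show "cmod (?w j * z) \<le> t0 + 1" "cmod (?w j * z') \<le> t0 + 1"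
          using that by (simp_all add: norm_mult norm_power)
        show "cmod (?w j * z' - ?w j * z) < d0"
          using that by (simp add: norm_mult norm_power flip: right_diff_distrib)
      qed
    qed (auto simp: norm_divide)
    also have "\<dots> = 1 / 4" using that by simp
    finally show ?thesis .
  qed
  have step: "P (t + d / 4)" if t: "0 \<le> t" "P t" "t \<le> t0" for t
  proof -
    define s where "s = t + d / 2"
    have s: "0 < s" "t < s" "s \<le> t0 + 1" using t d by (auto simp: s_def)
    have "\<forall>\<^sub>F n in sequentially. t ^ n * norm (x ^ n) < 1 / 8"
      using t(2) unfolding P_def by (rule order_tendstoD) auto
    then have ev: "\<forall>\<^sub>F n in sequentially. s ^ n * norm (x ^ n) \<le> norm (1 :: 'a)"
      using eventually_gt_at_top[of 0]
    proof eventually_elim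
      case (elim n)
      define u where "u = of_real t ^ n *\<^sub>C x ^ n"
      define v where "v = of_real s ^ n *\<^sub>C x ^ n"
      have u: "norm u < 1 / 8" and v: "norm v = s ^ n * norm (x ^ n)"
        using elim t s by (simp_all add: u_def v_def norm_scaleC norm_power)
      \<comment> \<open>\<open>F (1 - u) = 1\<close> with small \<open>u\<close> makes \<open>F - 1\<close> small \<dots>\<close>
      have Fu: "F n (of_real t) - 1 = (F n (of_real t) - 1) * u + u"
        using F[OF elim(2), of "of_real t"] by (simp add: u_def algebra_simps)
      have "norm (F n (of_real t) - 1) \<le> norm (F n (of_real t) - 1) * norm u + norm u"
        by (subst Fu) (meson add_right_mono norm_mult_ineq norm_triangle_le order_trans)
      also have "\<dots> \<le> norm (F n (of_real t) - 1) * (1 / 8) + 1 / 8"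
        using u by (intro add_mono mult_left_mono) auto
      finally have "norm (F n (of_real t) - 1) \<le> 1 / 4" by simp
      moreover have "norm (F n (of_real s) - F n (of_real t)) \<le> 1 / 4"
        using elim s t d by (intro Fdiff) (simp_all add: s_def del: of_real_add flip: of_real_diff)
      ultimately have E: "norm (F n (of_real s) - 1) \<le> 1 / 2"
        using norm_triangle_ineq[of "F n (of_real s) - F n (of_real t)" "F n (of_real t) - 1"]
        by simp
      \<comment> \<open>\<dots> and \<open>F (1 - v) = 1\<close> with \<open>\<parallel>F - 1\<parallel> \<le> 1 / 2\<close> bounds \<open>v\<close>.\<close>
      have "v = (F n (of_real s) - 1) * (1 - v)"
        using F[OF elim(2), of "of_real s"] by (simp add: v_def algebra_simps)
      then have "norm v \<le> norm (F n (of_real s) - 1) * norm (1 - v)"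
        by (metis norm_mult_ineq)
      also have "\<dots> \<le> 1 / 2 * (norm (1 :: 'a) + norm v)"
        using E by (intro mult_mono norm_triangle_ineq4) auto
      finally show ?case using v by simp
    qed
    show ?thesis unfolding P_def
    proof (rule Lim_null_comparison)
      show "\<forall>\<^sub>F n in sequentially. norm ((t + d / 4) ^ n * norm (x ^ n))
          \<le> ((t + d / 4) / s) ^ n * norm (1 :: 'a)"
        using ev
      proof eventually_elim
        case (elim n)
        have "(t + d / 4) ^ n * norm (x ^ n) = ((t + d / 4) / s) ^ n * (s ^ n * norm (x ^ n))"
          using s by (simp add: power_divide)
        also have "\<dots> \<le> ((t + d / 4) / s) ^ n * norm (1 :: 'a)"
          using elim s t d by (intro mult_left_mono) auto
        finally show ?case using t d by simp
      qed
      have "(\<lambda>n. ((t + d / 4) / s) ^ n) \<longlonglongrightarrow> 0"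
        using s t d by (intro LIMSEQ_realpow_zero) (auto simp: s_def)
      then show "(\<lambda>n. ((t + d / 4) / s) ^ n * norm (1 :: 'a)) \<longlonglongrightarrow> 0"
        by (rule tendsto_mult_left_zero)
    qed
  qed
  have Pk: "real k * (d / 4) \<le> t0 + d / 4 \<longrightarrow> P (real k * (d / 4))" for k
  proof (induction k)
    case 0
    have "\<forall>\<^sub>F n in sequentially. (0::real) ^ n * norm (x ^ n) = 0"
      using eventually_gt_at_top[of 0] by eventually_elim simp
    then show ?case by (simp add: P_def tendsto_eventually)
  next
    case (Suc k)
    show ?case
    proof
      assume "real (Suc k) * (d / 4) \<le> t0 + d / 4"
      then have k: "real k * (d / 4) \<le> t0" by (simp add: algebra_simps)
      then have "P (real k * (d / 4) + d / 4)"
        using Suc d by (intro step) auto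
      then show "P (real (Suc k) * (d / 4))"
        by (simp only: of_nat_Suc distrib_right mult_1_left add.commute)
    qed
  qed
  \<comment> \<open>The least number of steps of length \<open>d / 4\<close> that reaches \<open>t0\<close>.\<close>
  define k where "k = nat \<lceil>t0 / (d / 4)\<rceil>"
  have "t0 / (d / 4) \<le> real k" "real k \<le> t0 / (d / 4) + 1"
    using t0 d by (simp_all add: k_def)
  then have k: "t0 \<le> real k * (d / 4)" "real k * (d / 4) \<le> t0 + d / 4"
    using d by (simp_all add: field_simps)
  show ?thesis
  proof (rule Lim_null_comparison)
    show "\<forall>\<^sub>F n in sequentially. norm (t0 ^ n * norm (x ^ n)) \<le> (real k * (d / 4)) ^ n * norm (x ^ n)"
      using t0 k by (intro always_eventually allI) (simp add: mult_right_mono power_mono)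
    show "(\<lambda>n. (real k * (d / 4)) ^ n * norm (x ^ n)) \<longlonglongrightarrow> 0"
      using Pk k unfolding P_def by blast
  qed
qed

section \<open>Quasi-nilpotent and nilpotent elements\<close>

lemma commute_inverse:
  fixes u v z :: "'a::monoid_mult"
  assumes "u * v = 1" "v * u = 1" "u * z = z * u"
  shows "v * z = z * v"
proof -
  have "v * z = v * (z * u) * v" using assms by (simp add: mult.assoc)
  also have "\<dots> = z * v" using assms by (simp flip: assms(3) mult.assoc)
  finally show ?thesis .
qed

lemma norm_power_mult_le:
  fixes v z :: "'a::{real_algebra_1, real_normed_algebra}"
  shows "norm (v ^ n * z) \<le> norm v ^ n * norm z"
proof (induction n)
  case (Suc n)
  have "norm (v ^ Suc n * z) \<le> norm v * norm (v ^ n * z)"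
    by (simp add: mult.assoc norm_mult_ineq)
  also have "\<dots> \<le> norm v * (norm v ^ n * norm z)"
    using Suc by (intro mult_left_mono) auto
  finally show ?case by (simp add: mult.assoc)
qed simp

lemma invertible_one_minus_iff:
  assumes "z \<noteq> 0"
  shows "invertible_elt (1 - z *\<^sub>C x) \<longleftrightarrow> 1 / z \<notin> spectrum x"
proof -
  have eq: "1 - z *\<^sub>C x = z *\<^sub>C (of_complex (1 / z) - x)"
    using assms by (simp add: of_complex_def scaleC.scale_right_diff_distrib)
  have "invertible_elt (z *\<^sub>C u) \<longleftrightarrow> invertible_elt u" for u :: 'a
  proof
    assume "invertible_elt u"
    then obtain v where "u * v = 1" "v * u = 1" unfolding invertible_elt_def by blast
    then show "invertible_elt (z *\<^sub>C u)"
      unfolding invertible_elt_def using assms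
      by (intro exI[of _ "(1 / z) *\<^sub>C v"]) (simp add: mult_scaleC_left mult_scaleC_right)
  next
    assume "invertible_elt (z *\<^sub>C u)"
    then obtain v where "(z *\<^sub>C u) * v = 1" "v * (z *\<^sub>C u) = 1"
      unfolding invertible_elt_def by blast
    then show "invertible_elt u"
      unfolding invertible_elt_def
      by (intro exI[of _ "z *\<^sub>C v"]) (simp add: mult_scaleC_left mult_scaleC_right)
  qed
  then show ?thesis by (simp add: eq spectrum_def)
qed

lemma quasinilpotent_pencil:
  assumes "quasinilpotent x"
  obtains R where "\<And>z. R z * (1 - z *\<^sub>C x) = 1" "\<And>z. (1 - z *\<^sub>C x) * R z = 1"
proof -
  have "invertible_elt (1 - z *\<^sub>C x)" for z
  proof (cases "z = 0")
    case True
    then show ?thesis by (auto simp: invertible_elt_def)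
  next
    case False
    then show ?thesis
      using assms by (simp add: invertible_one_minus_iff quasinilpotent_def)
  qed
  then have "\<forall>z. \<exists>y. (1 - z *\<^sub>C x) * y = 1 \<and> y * (1 - z *\<^sub>C x) = 1"
    by (simp add: invertible_elt_def)
  then show ?thesis by (metis that)
qed

lemma quasinilpotent_power_decay:
  fixes x :: "'a::complex_banach_algebra_1"
  assumes "quasinilpotent x" and "t \<ge> 0"
  shows "(\<lambda>n. t ^ n * norm (x ^ n)) \<longlonglongrightarrow> 0"
proof -
  obtain R where "\<And>z. R z * (1 - z *\<^sub>C x) = 1" "\<And>z. (1 - z *\<^sub>C x) * R z = 1"
    using quasinilpotent_pencil[OF assms(1)] by metis
  then show ?thesis by (rule power_decay_if_pencil_invertible) (rule assms(2))
qed

text \<open>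
  The average \<open>F\<close> of \<open>R\<close> over the points \<open>\<omega> s\<close> with \<open>\<omega>\<^sup>m = 1\<close> gives \<open>x\<^sup>N = x\<^sup>N F (1 - s\<^sup>m x\<^sup>m)\<close>. The factor
  \<open>x\<^sup>N F\<close> is bounded by \<open>M / s\<close>, and the last factor tends to \<open>1\<close> as \<open>m\<close> grows. Then let \<open>s\<close> grow.
\<close>

lemma nilpotent_if_pencil_bounded:
  fixes x :: "'a::complex_banach_algebra_1"
  assumes qn: "quasinilpotent x"
    and L: "\<And>z. R z * (1 - z *\<^sub>C x) = 1"
    and bound: "\<And>z. cmod z > K \<Longrightarrow> norm (x ^ N * R z) \<le> M / cmod z"
  shows "x ^ N = 0"
proof -
  have le: "norm (x ^ N) \<le> M / s * norm (1 :: 'a)" if s: "s > max 0 K" for s :: real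
  proof (rule tendsto_lowerbound)
    have "(\<lambda>m. M / s * (norm (1 :: 'a) + s ^ m * norm (x ^ m))) \<longlonglongrightarrow> M / s * (norm (1 :: 'a) + 0)"
      using s by (intro tendsto_intros quasinilpotent_power_decay[OF qn]) simp
    then show "(\<lambda>m. M / s * (norm (1 :: 'a) + s ^ m * norm (x ^ m))) \<longlonglongrightarrow> M / s * norm (1 :: 'a)"
      by simp
    show "\<forall>\<^sub>F m in sequentially. norm (x ^ N) \<le> M / s * (norm (1 :: 'a) + s ^ m * norm (x ^ m))"
      using eventually_gt_at_top[of 0]
    proof eventually_elim
      case (elim m)
      define z where "z = complex_of_real s"
      define F where "F = (1 / of_nat m) *\<^sub>C (\<Sum>j<m. R (cis (2 * pi / real m) ^ j * z))"
      have "F * (1 - (z *\<^sub>C x) ^ m) = 1"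
        unfolding F_def
        by (rule roots_of_unity_average[OF elim]) (simp add: scaleC_scaleC L)
      then have "x ^ N = (x ^ N * F) * (1 - (z *\<^sub>C x) ^ m)"
        by (simp add: mult.assoc)
      then have "norm (x ^ N) \<le> norm (x ^ N * F) * norm (1 - (z *\<^sub>C x) ^ m)"
        by (metis norm_mult_ineq)
      also have "\<dots> \<le> M / s * (norm (1 :: 'a) + s ^ m * norm (x ^ m))"
      proof (rule mult_mono)
        have "x ^ N * F = (1 / of_nat m) *\<^sub>C (\<Sum>j<m. x ^ N * R (cis (2 * pi / real m) ^ j * z))"
          by (simp add: F_def mult_scaleC_right sum_distrib_left)
        also have "norm \<dots> \<le> 1 / real m * (\<Sum>j<m. M / s)"
          unfolding norm_scaleC
        proof (intro mult_mono sum_norm_le)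
          fix j
          have "cmod (cis (2 * pi / real m) ^ j * z) = s"
            using s by (simp add: z_def norm_mult norm_power)
          then show "norm (x ^ N * R (cis (2 * pi / real m) ^ j * z)) \<le> M / s"
            using bound[of "cis (2 * pi / real m) ^ j * z"] s by simp
        qed (auto simp: norm_divide)
        also have "\<dots> = M / s" using elim by simp
        finally show FM: "norm (x ^ N * F) \<le> M / s" .
        show "0 \<le> M / s" using FM norm_ge_zero order_trans by blast
        show "norm (1 - (z *\<^sub>C x) ^ m) \<le> norm (1 :: 'a) + s ^ m * norm (x ^ m)"
          using norm_triangle_ineq4[of 1 "(z *\<^sub>C x) ^ m"] s
          by (simp add: scaleC_power norm_scaleC norm_power z_def)
      qed auto
      finally show ?case .
    qed
  qed simp
  have "norm (x ^ N) \<le> 0"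
  proof (rule tendsto_lowerbound)
    show "((\<lambda>s. M / s * norm (1 :: 'a)) \<longlongrightarrow> 0) at_top"
      by (intro tendsto_mult_left_zero tendsto_divide_0[OF tendsto_const]
          filterlim_at_top_imp_at_infinity filterlim_ident)
    show "\<forall>\<^sub>F s in at_top. norm (x ^ N) \<le> M / s * norm (1 :: 'a)"
      using eventually_gt_at_top[of "max 0 K"] by eventually_elim (rule le)
  qed simp
  then show ?thesis by simp
qed

lemma nilpotent_pencil_inverse:
  fixes x :: "'a::complex_banach_algebra_1"
  assumes "x ^ k = 0"
  shows "(1 - z *\<^sub>C x) * (\<Sum>j<k. z ^ j *\<^sub>C x ^ j) = 1"
    and "(\<Sum>j<k. z ^ j *\<^sub>C x ^ j) * (1 - z *\<^sub>C x) = 1"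
proof -
  show 1: "(1 - z *\<^sub>C x) * (\<Sum>j<k. z ^ j *\<^sub>C x ^ j) = 1"
    using one_minus_power_eq[of "z *\<^sub>C x" k] assms by (simp add: scaleC_power)
  have "(\<Sum>j<k. z ^ j *\<^sub>C x ^ j) * (z *\<^sub>C x) = (z *\<^sub>C x) * (\<Sum>j<k. z ^ j *\<^sub>C x ^ j)"
    by (simp add: sum_distrib_left sum_distrib_right mult_scaleC_left mult_scaleC_right
        power_commutes mult.commute scaleC.scale_sum_right)
  then show "(\<Sum>j<k. z ^ j *\<^sub>C x ^ j) * (1 - z *\<^sub>C x) = 1"
    using 1 by (simp only: left_diff_distrib right_diff_distrib mult_1_left mult_1_right)
qed

lemma nilpotent_imp_quasinilpotent:
  fixes x :: "'a::complex_banach_algebra_1"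
  assumes "x ^ k = 0"
  shows "quasinilpotent x"
proof -
  have "w \<notin> spectrum x" if "w \<noteq> 0" for w
    using nilpotent_pencil_inverse[OF assms, of "1 / w"] invertible_one_minus_iff[of "1 / w" x] that
    by (auto simp: invertible_elt_def)
  moreover have "\<not> invertible_elt (of_complex 0 - x)"
  proof
    assume "invertible_elt (of_complex 0 - x)"
    then obtain v where "x * (- v) = 1"
      by (auto simp: invertible_elt_def of_complex_def)
    then have "x ^ k * (- v) ^ k = 1" by (rule left_right_inverse_power)
    then show False using assms by simp
  qed
  ultimately show ?thesis
    by (auto simp: quasinilpotent_def spectrum_def)
qed

section \<open>Laurent expansions with finite singular part\<close>

text \<open>
  Since the terms of a convergent series are bounded, the series at a point of modulus \<open>r / 2\<close>
  dominates the series at points of modulus less than \<open>r / 4\<close> by a geometric series.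
\<close>

lemma laurent_expansion_at_bounded:
  fixes f :: "complex \<Rightarrow> 'a::complex_banach_algebra_1"
  assumes "laurent_expansion_at f d z" and "finite {n. n < 0 \<and> d n \<noteq> 0}"
  obtains N M r where "N \<ge> 1" "r > 0"
    "\<And>w. \<lbrakk>0 < cmod w; cmod w < r\<rbrakk> \<Longrightarrow> norm (w ^ N *\<^sub>C f (z + w)) \<le> M"
proof -
  obtain r where r: "r > 0"
    and hs: "\<And>u. \<lbrakk>0 < cmod (u - z); cmod (u - z) < r\<rbrakk> \<Longrightarrow>
        ((\<lambda>n. ((u - z) powi n) *\<^sub>C d n) has_sum f u) UNIV"
    using assms(1) unfolding laurent_expansion_at_def by blast
  obtain B where B: "\<And>n. n \<in> {n. n < 0 \<and> d n \<noteq> 0} \<Longrightarrow> B \<le> n"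
    using assms(2) bdd_below_finite[of "{n. n < 0 \<and> d n \<noteq> 0}"] unfolding bdd_below_def by blast
  define N where "N = nat (- B) + 1"
  have N: "d n = 0" if "n < - int N" for n
  proof (rule ccontr)
    assume "d n \<noteq> 0"
    then have "B \<le> n" using B[of n] that by simp
    then show False using that unfolding N_def by linarith
  qed
  define e where "e k = d (int k - int N)" for k
  have S: "(\<lambda>k. w ^ k *\<^sub>C e k) sums (w ^ N *\<^sub>C f (z + w))" if w: "0 < cmod w" "cmod w < r" for w
  proof -
    define g where "g n = (w powi n) *\<^sub>C d n" for n
    define h where "h k = int k - int N" for k
    have "(g has_sum f (z + w)) UNIV"
      using hs[of "z + w"] w by (simp add: g_def[abs_def])
    also have "?this \<longleftrightarrow> (g has_sum f (z + w)) (range h)"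
    proof (rule has_sum_cong_neutral)
      fix n assume n: "n \<in> UNIV - range h"
      have "n < - int N"
      proof (rule ccontr)
        assume "\<not> n < - int N"
        then have "n = h (nat (n + int N))" by (simp add: h_def)
        then show False using n by blast
      qed
      then show "g n = 0" by (simp add: g_def N)
    qed auto
    also have "\<dots> \<longleftrightarrow> ((g \<circ> h) has_sum f (z + w)) UNIV"
      by (intro has_sum_reindex) (auto simp: h_def inj_on_def)
    finally have "(g \<circ> h) sums f (z + w)" by (rule has_sum_imp_sums)
    from sums_mult[OF this, of "of_complex (w ^ N)"]
    have "(\<lambda>k. w ^ N *\<^sub>C g (h k)) sums (w ^ N *\<^sub>C f (z + w))" by simp
    also have "(\<lambda>k. w ^ N *\<^sub>C g (h k)) = (\<lambda>k. w ^ k *\<^sub>C e k)"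
      using w by (auto simp: g_def h_def e_def power_int_diff scaleC_scaleC)
    finally show ?thesis .
  qed
  have "summable (\<lambda>k. of_real (r / 2) ^ k *\<^sub>C e k)"
    by (rule sums_summable, rule S) (use r in auto)
  then have "Bseq (\<lambda>k. of_real (r / 2) ^ k *\<^sub>C e k)"
    by (intro convergent_imp_Bseq convergentI[of _ 0] summable_LIMSEQ_zero)
  then obtain C where C: "\<And>k. norm (of_real (r / 2) ^ k *\<^sub>C e k) \<le> C"
    unfolding Bseq_def by blast
  show ?thesis
  proof
    show "N \<ge> 1" by (simp add: N_def)
    show "r / 4 > 0" using r by simp
    fix w assume w: "0 < cmod w" "cmod w < r / 4"
    have eq: "w ^ N *\<^sub>C f (z + w) = (\<Sum>k. w ^ k *\<^sub>C e k)"
      using S[of w] w r by (simp add: sums_iff)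
    have "norm (\<Sum>k. w ^ k *\<^sub>C e k) \<le> (\<Sum>k. (1 / 2) ^ k * C)"
    proof (rule norm_suminf_le)
      show "summable (\<lambda>k. (1 / 2 :: real) ^ k * C)"
        by (intro summable_mult2 summable_geometric) simp
      fix k
      have "norm (w ^ k *\<^sub>C e k) = (cmod w / (r / 2)) ^ k * norm (of_real (r / 2) ^ k *\<^sub>C e k)"
        using r by (simp add: norm_scaleC norm_power norm_divide power_divide field_simps)
      also have "\<dots> \<le> (1 / 2) ^ k * C"
        using w r C[of k] by (intro mult_mono power_mono) (auto simp: field_simps)
      finally show "norm (w ^ k *\<^sub>C e k) \<le> (1 / 2) ^ k * C" .
    qed
    then show "norm (w ^ N *\<^sub>C f (z + w)) \<le> (\<Sum>k. (1 / 2) ^ k * C)" by (simp add: eq)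
  qed
qed

section \<open>The resolvent near a splitting of the spectrum\<close>

text \<open>
  The element \<open>c\<close> commutes with the idempotent \<open>q\<close>, and its block in the corner at \<open>1 - q\<close> is invertible
  there with inverse \<open>y\<close>. The equations \<open>q y = y q = 0\<close> say that \<open>y\<close> lies in that corner, so
  that \<open>c\<close> may be used in place of its block \<open>(1 - q) c (1 - q)\<close>.
\<close>

locale corner_splitting =
  fixes c q y :: "'a::complex_banach_algebra_1"
  assumes idem: "q * q = q"
    and comm: "c * q = q * c"
    and cy: "c * y = 1 - q" and yc: "y * c = 1 - q"
    and qy: "q * y = 0" and yq: "y * q = 0"
begin

text \<open>
  The Neumann series for the inverse of \<open>c - w\<close> in the corner at \<open>1 - q\<close>, when \<open>\<bar>w\<bar> \<parallel>y\<parallel> < 1\<close>.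
\<close>

definition corner_resolvent :: "complex \<Rightarrow> 'a" where
  "corner_resolvent w = (\<Sum>n. w ^ n *\<^sub>C y ^ Suc n)"

lemma corner_power: "(c * q) ^ n * q = c ^ n * q"
proof (induction n)
  case (Suc n)
  have "(c * q) ^ Suc n * q = c * q * ((c * q) ^ n * q)" by (simp add: mult.assoc)
  also have "\<dots> = c * (q * c ^ n) * q" by (simp add: Suc mult.assoc)
  also have "q * c ^ n = c ^ n * q" using comm by (rule power_commuting_commutes[symmetric])
  finally show ?case by (simp add: mult.assoc idem)
qed simp

lemma summable_corner_resolvent:
  assumes "cmod w * norm y < 1"
  shows "summable (\<lambda>n. norm (w ^ n *\<^sub>C y ^ Suc n))"
proof (rule summable_comparison_test')
  show "summable (\<lambda>n. (cmod w * norm y) ^ n * norm y)"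
    using assms by (intro summable_mult2 summable_geometric) simp
  fix n
  show "norm (norm (w ^ n *\<^sub>C y ^ Suc n)) \<le> (cmod w * norm y) ^ n * norm y"
    using norm_power_mult_le[of y n y]
    by (simp add: norm_scaleC norm_power power_mult_distrib power_commutes mult.assoc mult_left_mono)
qed

lemma
  assumes "cmod w * norm y < 1"
  shows c_mult_corner_resolvent: "c * corner_resolvent w = 1 - q + w *\<^sub>C corner_resolvent w"
    and corner_resolvent_mult_c: "corner_resolvent w * c = 1 - q + w *\<^sub>C corner_resolvent w"
    and q_mult_corner_resolvent: "q * corner_resolvent w = 0"
    and corner_resolvent_mult_q: "corner_resolvent w * q = 0"
proof -
  let ?f = "\<lambda>n. w ^ n *\<^sub>C y ^ Suc n"
  have sm: "summable ?f" using summable_corner_resolvent[OF assms] by (rule summable_norm_cancel)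
  have y1: "(1 - q) * y = y" "y * (1 - q) = y" by (simp_all add: algebra_simps qy yq)
  have cy': "c * y ^ Suc (Suc n) = y ^ Suc n" for n
  proof -
    have "c * y ^ Suc (Suc n) = (c * y) * y * y ^ n" by (simp add: mult.assoc)
    then show ?thesis by (simp add: cy y1)
  qed
  have yc': "y ^ Suc (Suc n) * c = y ^ Suc n" for n
  proof -
    have "y ^ Suc (Suc n) * c = y ^ n * (y * (y * c))"
      by (simp only: power_Suc2 mult.assoc)
    then show ?thesis by (simp add: yc y1 power_commutes)
  qed
  have "c * corner_resolvent w = (\<Sum>n. c * ?f n)"
    unfolding corner_resolvent_def by (rule suminf_mult[OF sm, symmetric])
  also have "\<dots> = c * ?f 0 + (\<Sum>n. c * ?f (Suc n))"
    using suminf_split_head[OF summable_mult[OF sm, of c]] by simp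
  also have "(\<lambda>n. c * ?f (Suc n)) = (\<lambda>n. of_complex w * ?f n)"
    by (simp add: mult_scaleC_right cy' scaleC_scaleC del: power_Suc) (simp add: scaleC_scaleC mult.commute)
  also have "(\<Sum>n. of_complex w * ?f n) = w *\<^sub>C corner_resolvent w"
    unfolding corner_resolvent_def by (subst suminf_mult[OF sm]) simp
  finally show "c * corner_resolvent w = 1 - q + w *\<^sub>C corner_resolvent w" by (simp add: cy)
  have "corner_resolvent w * c = (\<Sum>n. ?f n * c)"
    unfolding corner_resolvent_def by (rule suminf_mult2[OF sm])
  also have "\<dots> = ?f 0 * c + (\<Sum>n. ?f (Suc n) * c)"
    using suminf_split_head[OF summable_mult2[OF sm, of c]] by simp
  also have "(\<lambda>n. ?f (Suc n) * c) = (\<lambda>n. of_complex w * ?f n)"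
    by (simp add: mult_scaleC_left yc' scaleC_scaleC del: power_Suc) (simp add: scaleC_scaleC mult.commute)
  also have "(\<Sum>n. of_complex w * ?f n) = w *\<^sub>C corner_resolvent w"
    unfolding corner_resolvent_def by (subst suminf_mult[OF sm]) simp
  finally show "corner_resolvent w * c = 1 - q + w *\<^sub>C corner_resolvent w" by (simp add: yc)
  have "q * ?f n = 0" for n
    by (simp add: mult_scaleC_right qy flip: mult.assoc)
  then show "q * corner_resolvent w = 0"
    unfolding corner_resolvent_def by (subst suminf_mult[OF sm, symmetric]) simp
  have "?f n * q = 0" for n
    by (simp add: mult_scaleC_left yq power_Suc2 mult.assoc del: power_Suc)
  then show "corner_resolvent w * q = 0"
    unfolding corner_resolvent_def by (subst suminf_mult2[OF sm]) simp
qed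

lemma pencil_inverse_commutes_q:
  assumes "R * (1 - z *\<^sub>C (c * q)) = 1" "(1 - z *\<^sub>C (c * q)) * R = 1"
  shows "R * q = q * R"
proof (rule commute_inverse[OF assms(2,1)])
  have "c * q * q = q * (c * q)" by (metis comm mult.assoc idem)
  then show "(1 - z *\<^sub>C (c * q)) * q = q * (1 - z *\<^sub>C (c * q))"
    by (simp add: algebra_simps mult_scaleC_left mult_scaleC_right)
qed

text \<open>
  On the corner at \<open>q\<close> the inverse of \<open>w - c\<close> is that of \<open>w - c q = w (1 - (1 / w) c q)\<close>, restricted to
  the corner; on the corner at \<open>1 - q\<close> it is the negative of the Neumann series.
\<close>

lemma shifted_inverse:
  assumes w: "w \<noteq> 0" "cmod w * norm y < 1"
    and R: "R * (1 - (1 / w) *\<^sub>C (c * q)) = 1" "(1 - (1 / w) *\<^sub>C (c * q)) * R = 1"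
  shows "(of_complex w - c) * ((1 / w) *\<^sub>C (R * q) - corner_resolvent w) = 1"
    and "((1 / w) *\<^sub>C (R * q) - corner_resolvent w) * (of_complex w - c) = 1"
proof -
  have Rq: "R * q = q * R" using pencil_inverse_commutes_q[OF R] .
  have "(of_complex w - c) * ((1 / w) *\<^sub>C (q * R)) = ((1 - (1 / w) *\<^sub>C (c * q)) * q) * R"
    using w by (simp add: left_diff_distrib mult_scaleC_left mult_scaleC_right
        scaleC.scale_right_diff_distrib scaleC_scaleC idem mult.assoc)
  also have "(1 - (1 / w) *\<^sub>C (c * q)) * q = q * (1 - (1 / w) *\<^sub>C (c * q))"
    by (simp add: algebra_simps mult_scaleC_left mult_scaleC_right)
       (metis comm mult.assoc idem)
  also have "\<dots> * R = q" by (simp add: mult.assoc R)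
  finally show "(of_complex w - c) * ((1 / w) *\<^sub>C (R * q) - corner_resolvent w) = 1"
    using w by (simp add: Rq right_diff_distrib left_diff_distrib c_mult_corner_resolvent)
  have "((1 / w) *\<^sub>C (R * q)) * (of_complex w - c) = R * ((1 - (1 / w) *\<^sub>C (c * q)) * q)"
    using w by (simp add: right_diff_distrib left_diff_distrib mult_scaleC_left mult_scaleC_right
        scaleC.scale_right_diff_distrib scaleC_scaleC idem mult.assoc flip: comm)
  also have "\<dots> = q" by (simp add: R flip: mult.assoc)
  finally show "((1 / w) *\<^sub>C (R * q) - corner_resolvent w) * (of_complex w - c) = 1"
    using w by (simp add: right_diff_distrib left_diff_distrib corner_resolvent_mult_c
        scaleC.scale_right_diff_distrib) (simp add: algebra_simps)
qed

lemma not_invertible: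
  assumes "quasinilpotent (c * q)" and "q \<noteq> 0"
  shows "\<not> invertible_elt c"
proof
  assume "invertible_elt c"
  then obtain v where v: "v * c = 1" unfolding invertible_elt_def by blast
  have q: "q = v ^ n * ((c * q) ^ n * q)" for n
    unfolding corner_power by (simp add: left_right_inverse_power[OF v] flip: mult.assoc)
  have "norm q \<le> norm v ^ n * norm ((c * q) ^ n) * norm q" for n
  proof -
    have "norm q \<le> norm v ^ n * norm ((c * q) ^ n * q)"
      by (subst q[of n]) (rule norm_power_mult_le)
    also have "\<dots> \<le> norm v ^ n * (norm ((c * q) ^ n) * norm q)"
      by (intro mult_left_mono norm_mult_ineq) auto
    finally show ?thesis by (simp add: mult.assoc)
  qed
  moreover have "(\<lambda>n. norm v ^ n * norm ((c * q) ^ n) * norm q) \<longlonglongrightarrow> 0"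
    using quasinilpotent_power_decay[OF assms(1)] by (intro tendsto_mult_left_zero) auto
  ultimately have "norm q \<le> 0"
    by (intro tendsto_lowerbound[of _ 0 sequentially]) auto
  then show False using assms(2) by simp
qed

end

text \<open>
  If \<open>v\<close> is the inverse of \<open>c + q\<close>, where \<open>c = b - \<mu>\<close>, then \<open>y = v (1 - q)\<close> is the inverse in the
  corner. Conversely, \<open>c + q\<close> is inverted by \<open>y + q (1 + c q)\<^sup>-\<^sup>1\<close>, as \<open>-1\<close> is not in the spectrum of \<open>c q\<close>.
\<close>

lemma spectral_idempotent_iff_splitting:
  "spectral_idempotent b \<mu> q \<longleftrightarrow>
     q \<noteq> 0 \<and> quasinilpotent ((b - of_complex \<mu>) * q) \<and>
     (\<exists>y. corner_splitting (b - of_complex \<mu>) q y)"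
proof -
  define c where "c = b - of_complex \<mu>"
  have bq: "b * q = q * b \<longleftrightarrow> c * q = q * c"
    by (simp add: c_def left_diff_distrib right_diff_distrib)
  have 1: "\<exists>y. corner_splitting c q y"
    if q: "q * q = q" "c * q = q * c" and inv: "invertible_elt (c + q)"
  proof -
    from inv obtain v where v: "(c + q) * v = 1" "v * (c + q) = 1"
      unfolding invertible_elt_def by blast
    have vq: "v * q = q * v"
      using v by (rule commute_inverse) (simp add: algebra_simps q)
    have e: "q * (1 - q) = 0" "(1 - q) * q = 0" "(1 - q) * (1 - q) = 1 - q"
      by (simp_all add: algebra_simps q)
    have v': "v * (1 - q) = (1 - q) * v" by (simp add: algebra_simps vq)
    have "c * (v * (1 - q)) = (c + q) * v * (1 - q) - q * (v * (1 - q))"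
      by (simp add: algebra_simps)
    also have "q * (v * (1 - q)) = 0" unfolding v' by (simp add: e flip: mult.assoc)
    finally have 1: "c * (v * (1 - q)) = 1 - q" by (simp add: v)
    have "((1 - q) * v) * c = (1 - q) * (v * (c + q)) - ((1 - q) * v) * q"
      by (simp add: algebra_simps)
    also have "((1 - q) * v) * q = 0" unfolding v'[symmetric] by (simp add: e mult.assoc)
    finally have 2: "((1 - q) * v) * c = 1 - q" by (simp add: v)
    have "corner_splitting c q (v * (1 - q))"
    proof
      show "v * (1 - q) * c = 1 - q" unfolding v' by (rule 2)
      show "q * (v * (1 - q)) = 0" unfolding v' by (simp add: e flip: mult.assoc)
      show "v * (1 - q) * q = 0" by (simp add: e mult.assoc)
    qed (use q 1 in auto)
    then show ?thesis by blast
  qed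
  have 2: "invertible_elt (c + q)" if "quasinilpotent (c * q)" "corner_splitting c q y" for y
  proof -
    interpret corner_splitting c q y by fact
    obtain R where R: "R * (1 - (-1) *\<^sub>C (c * q)) = 1" "(1 - (-1) *\<^sub>C (c * q)) * R = 1"
      using quasinilpotent_pencil[OF \<open>quasinilpotent (c * q)\<close>] by metis
    have Rq: "R * q = q * R" by (rule pencil_inverse_commutes_q[OF R])
    have m1: "(-1) *\<^sub>C x = - x" for x :: 'a using scaleC.scale_minus_left[of 1 x] by simp
    have "(c + q) * q = (1 + c * q) * q" by (simp add: algebra_simps idem)
    also have "\<dots> = q * (1 + c * q)" by (simp add: algebra_simps) (metis comm mult.assoc idem)
    finally have "(c + q) * (q * R) = q * ((1 + c * q) * R)" by (simp flip: mult.assoc)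
    then have A: "(c + q) * (q * R) = q" using R by (simp add: m1)
    have "q * (c + q) = (1 + c * q) * q" by (simp add: algebra_simps idem flip: comm)
    then have "(R * q) * (c + q) = (R * (1 + c * q)) * q" by (simp add: mult.assoc)
    then have B: "(R * q) * (c + q) = q" using R by (simp add: m1)
    have "(c + q) * (y + q * R) = 1" "(y + q * R) * (c + q) = 1"
      using A B by (simp_all only: distrib_left[of "c + q"] distrib_right[of y "q * R" "c + q"] Rq)
        (simp_all add: algebra_simps cy yc qy yq)
    then show ?thesis unfolding invertible_elt_def by blast
  qed
  show ?thesis
    unfolding spectral_idempotent_def idem_def bq c_def[symmetric]
    using 1 2 by (metis corner_splitting.idem corner_splitting.comm diff_add_eq c_def)
qed

lemma spectrum_shift:
  "\<mu> + w \<in> spectrum b \<longleftrightarrow> \<not> invertible_elt (of_complex w - (b - of_complex \<mu>))"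
  by (simp add: spectrum_def of_complex_add algebra_simps)

lemma resolvent_eqI:
  assumes "(of_complex \<mu> - b) * y = 1" "y * (of_complex \<mu> - b) = 1"
  shows "resolvent b \<mu> = y"
  unfolding resolvent_def
proof (rule the_equality)
  fix v assume v: "(of_complex \<mu> - b) * v = 1 \<and> v * (of_complex \<mu> - b) = 1"
  have "v = v * ((of_complex \<mu> - b) * y)" by (simp add: assms)
  also have "\<dots> = y" using v by (simp flip: mult.assoc)
  finally show "v = y" .
qed (use assms in blast)

lemma resolvent_shift:
  assumes "corner_splitting (b - of_complex \<mu>) q y"
    and w: "w \<noteq> 0" "cmod w * norm y < 1"
    and R: "R * (1 - (1 / w) *\<^sub>C ((b - of_complex \<mu>) * q)) = 1"
      "(1 - (1 / w) *\<^sub>C ((b - of_complex \<mu>) * q)) * R = 1"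
  shows "resolvent b (\<mu> + w) = (1 / w) *\<^sub>C (R * q) - corner_splitting.corner_resolvent y w"
    and "\<mu> + w \<notin> spectrum b"
proof -
  interpret corner_splitting "b - of_complex \<mu>" q y by fact
  have eq: "of_complex (\<mu> + w) - b = of_complex w - (b - of_complex \<mu>)"
    by (simp add: of_complex_add)
  show "resolvent b (\<mu> + w) = (1 / w) *\<^sub>C (R * q) - corner_resolvent w"
    using shifted_inverse[OF w R] by (intro resolvent_eqI) (simp_all only: eq)
  show "\<mu> + w \<notin> spectrum b"
    unfolding spectrum_shift invertible_elt_def using shifted_inverse[OF w R] by blast
qed

lemma cmod_mult_norm_less_1:
  assumes "cmod w < 1 / (norm y + 1)"
  shows "cmod w * norm y < 1"
proof -
  have "norm y + 1 > 0" by (rule add_nonneg_pos) auto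
  then have "cmod w * (norm y + 1) < 1" using assms by (simp add: field_simps)
  moreover have "cmod w * norm y \<le> cmod w * (norm y + 1)" by (intro mult_left_mono) auto
  ultimately show ?thesis by linarith
qed

lemma spectral_idempotent_imp_isolated:
  assumes "spectral_idempotent b \<mu> q"
  shows "\<mu> \<in> iso_spectrum b"
proof -
  obtain y where q: "q \<noteq> 0" "quasinilpotent ((b - of_complex \<mu>) * q)"
    and sp: "corner_splitting (b - of_complex \<mu>) q y"
    using assms unfolding spectral_idempotent_iff_splitting by blast
  obtain R where R: "\<And>z. R z * (1 - z *\<^sub>C ((b - of_complex \<mu>) * q)) = 1"
     "\<And>z. (1 - z *\<^sub>C ((b - of_complex \<mu>) * q)) * R z = 1"
    using quasinilpotent_pencil[OF q(2)] by metis
  have "\<not> invertible_elt (- (b - of_complex \<mu>))"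
    using corner_splitting.not_invertible[OF sp q(2,1)]
    by (metis invertible_elt_def minus_mult_commute minus_mult_minus)
  then have mem: "\<mu> \<in> spectrum b" by (simp add: spectrum_def)
  have "\<mu>' \<notin> spectrum b" if "\<mu>' \<in> ball \<mu> (1 / (norm y + 1))" "\<mu>' \<noteq> \<mu>" for \<mu>'
    using resolvent_shift(2)[OF sp _ cmod_mult_norm_less_1 R, of "\<mu>' - \<mu>"] that
    by (simp add: dist_norm norm_minus_commute)
  moreover have "\<mu> \<in> ball \<mu> (1 / (norm y + 1))"
    by (simp add: add_nonneg_pos)
  ultimately have "ball \<mu> (1 / (norm y + 1)) \<inter> spectrum b = {\<mu>}"
    using mem by blast
  then show ?thesis
    unfolding iso_spectrum_def isolated_in_def using mem open_ball by blast
qed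

section \<open>Poles and nilpotency\<close>

lemma pole_imp_nilpotent:
  assumes "spectral_idempotent b \<mu> q" and "\<mu> \<in> poles b"
  obtains k where "k \<ge> 1" "((b - of_complex \<mu>) * q) ^ k = 0"
proof -
  define x where "x = (b - of_complex \<mu>) * q"
  obtain y where qn: "quasinilpotent x" and sp: "corner_splitting (b - of_complex \<mu>) q y"
    using assms unfolding spectral_idempotent_iff_splitting x_def by blast
  interpret corner_splitting "b - of_complex \<mu>" q y by fact
  obtain R where R: "\<And>z. R z * (1 - z *\<^sub>C x) = 1" "\<And>z. (1 - z *\<^sub>C x) * R z = 1"
    using quasinilpotent_pencil[OF qn] by metis
  have Rq: "R z * q = q * R z" for z
    using R unfolding x_def by (rule pencil_inverse_commutes_q)
  obtain d where "laurent_expansion_at (resolvent b) d \<mu>" "finite {n. n < 0 \<and> d n \<noteq> 0}"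
    using assms(2) unfolding poles_def by blast
  then obtain N M r where N: "N \<ge> 1" and r: "r > 0"
    and bd: "\<And>w. \<lbrakk>0 < cmod w; cmod w < r\<rbrakk> \<Longrightarrow> norm (w ^ N *\<^sub>C resolvent b (\<mu> + w)) \<le> M"
    by (rule laurent_expansion_at_bounded) blast
  define K where "K = (\<Sum>k<N. norm (x ^ k * q))"
  have key: "norm (x ^ N * R (1 / w)) \<le> cmod w * (M * norm q + K)"
    if w: "w \<noteq> 0" "cmod w < r" "cmod w < 1 / (norm y + 1)" "cmod w < 1" for w
  proof -
    define z where "z = 1 / w"
    have zw: "z * w = 1" "w * z = 1" using w by (simp_all add: z_def)
    have wz: "w ^ n * z ^ n = 1" for n using zw by (simp flip: power_mult_distrib)
    have xqx: "x * q = x" by (simp add: x_def mult.assoc idem)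
    have xN: "x ^ N * q = x ^ N"
      using N xqx by (cases N) (simp_all add: power_Suc2 mult.assoc del: power_Suc)
    \<comment> \<open>In the corner at \<open>q\<close> the resolvents of \<open>b - \<mu>\<close> and of \<open>x\<close> agree.\<close>
    have res: "resolvent b (\<mu> + w) * q = z *\<^sub>C (R z * q)"
    proof -
      have "resolvent b (\<mu> + w) = z *\<^sub>C (R z * q) - corner_resolvent w"
        unfolding z_def
        by (rule resolvent_shift(1)[OF sp w(1) cmod_mult_norm_less_1[OF w(3)] R[unfolded x_def]])
      then show ?thesis
        by (simp add: left_diff_distrib mult_scaleC_left mult.assoc idem
            corner_resolvent_mult_q[OF cmod_mult_norm_less_1[OF w(3)]])
    qed
    \<comment> \<open>Up to a polynomial in \<open>z\<close> of degree less than \<open>N\<close>, \<open>z\<^sup>N x\<^sup>N R z\<close> is \<open>R z\<close>; multiplied by \<open>w\<^sup>N q\<close>, the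
      latter is \<open>w\<close> times a bounded function by the hypothesis on the pole, and the terms of the
      polynomial have order at least \<open>w\<close>.\<close>
    have "(1 - (z *\<^sub>C x) ^ N) * R z = (\<Sum>k<N. (z *\<^sub>C x) ^ k)"
    proof -
      have "1 - (z *\<^sub>C x) ^ N = (\<Sum>k<N. (z *\<^sub>C x) ^ k) * (1 - z *\<^sub>C x)"
        unfolding one_minus_power_eq
        by (simp add: left_diff_distrib right_diff_distrib sum_distrib_left sum_distrib_right
            sum_subtractf power_commutes)
      then show ?thesis by (simp add: mult.assoc R)
    qed
    then have "(z *\<^sub>C x) ^ N * R z = R z - (\<Sum>k<N. (z *\<^sub>C x) ^ k)"
      by (simp add: algebra_simps)
    then have "w ^ N *\<^sub>C ((z *\<^sub>C x) ^ N * R z) * q = w ^ N *\<^sub>C (R z - (\<Sum>k<N. (z *\<^sub>C x) ^ k)) * q"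
      by simp
    moreover have "w ^ N *\<^sub>C ((z *\<^sub>C x) ^ N * R z) * q = x ^ N * R z"
      by (simp add: scaleC_power mult_scaleC_left scaleC_scaleC wz mult.assoc Rq)
         (simp add: xN flip: mult.assoc)
    moreover have "w ^ N *\<^sub>C (R z - (\<Sum>k<N. (z *\<^sub>C x) ^ k)) * q
        = w *\<^sub>C ((w ^ N *\<^sub>C resolvent b (\<mu> + w)) * q)
          - (\<Sum>k<N. (w ^ N * z ^ k) *\<^sub>C (x ^ k * q))"
    proof -
      have "w *\<^sub>C ((w ^ N *\<^sub>C resolvent b (\<mu> + w)) * q) = (w ^ N * (w * z)) *\<^sub>C (R z * q)"
        by (simp only: mult_scaleC_left res scaleC_scaleC mult_ac)
      then show ?thesis
        by (simp add: zw mult_scaleC_left scaleC_scaleC left_diff_distrib scaleC_power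
          scaleC.scale_right_diff_distrib sum_distrib_right scaleC.scale_sum_right)
    qed
    ultimately have eq: "x ^ N * R z = w *\<^sub>C ((w ^ N *\<^sub>C resolvent b (\<mu> + w)) * q)
          - (\<Sum>k<N. (w ^ N * z ^ k) *\<^sub>C (x ^ k * q))"
      by (simp only:)
    have "norm (x ^ N * R z) \<le> norm (w *\<^sub>C ((w ^ N *\<^sub>C resolvent b (\<mu> + w)) * q))
          + norm (\<Sum>k<N. (w ^ N * z ^ k) *\<^sub>C (x ^ k * q))"
      unfolding eq by (rule norm_triangle_ineq4)
    also have "\<dots> \<le> cmod w * (M * norm q) + (\<Sum>k<N. cmod w * norm (x ^ k * q))"
    proof (intro add_mono sum_norm_le)
      have "norm ((w ^ N *\<^sub>C resolvent b (\<mu> + w)) * q) \<le> M * norm q"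
        using bd[of w] w by (intro order_trans[OF norm_mult_ineq] mult_right_mono) auto
      then show "norm (w *\<^sub>C ((w ^ N *\<^sub>C resolvent b (\<mu> + w)) * q)) \<le> cmod w * (M * norm q)"
        unfolding norm_scaleC by (intro mult_left_mono) auto
      fix k assume "k \<in> {..<N}"
      then have "w ^ N = w ^ (N - k) * w ^ k" by (simp flip: power_add)
      then have "cmod (w ^ N * z ^ k) = cmod w ^ (N - k)"
        using wz by (simp add: mult.assoc norm_power)
      also have "\<dots> \<le> cmod w ^ 1"
        using \<open>k \<in> {..<N}\<close> w by (intro power_decreasing) auto
      finally show "norm ((w ^ N * z ^ k) *\<^sub>C (x ^ k * q)) \<le> cmod w * norm (x ^ k * q)"
        unfolding norm_scaleC by (intro mult_right_mono) auto
    qed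
    also have "\<dots> = cmod w * (M * norm q + K)"
      by (simp add: K_def distrib_left sum_distrib_left)
    finally show ?thesis by (simp add: z_def)
  qed
  define r' where "r' = min r (min (1 / (norm y + 1)) 1)"
  have r': "r' > 0" using r by (simp add: r'_def add_nonneg_pos)
  have "x ^ N = 0"
  proof (rule nilpotent_if_pencil_bounded[OF qn R(1)])
    fix z assume z: "cmod z > 1 / r'"
    then have z0: "z \<noteq> 0" using r' by auto
    then have "cmod (1 / z) < r'" using z r' by (simp add: norm_divide field_simps)
    then show "norm (x ^ N * R z) \<le> (M * norm q + K) / cmod z"
      using key[of "1 / z"] z0 by (simp add: r'_def norm_divide)
  qed
  then show ?thesis using N that unfolding x_def by blast
qed

text \<open>
  With \<open>x = (b - \<mu>) q\<close> and \<open>y\<close> the inverse in the corner at \<open>1 - q\<close>, the Laurent coefficient of index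
  \<open>-j - 1\<close> is \<open>x\<^sup>j q\<close> and that of index \<open>n \<ge> 0\<close> is \<open>- y\<^sup>n\<^sup>+\<^sup>1\<close>. The one of index \<open>-1\<close> is \<open>q \<noteq> 0\<close>.
\<close>

lemma nilpotent_imp_pole:
  assumes si: "spectral_idempotent b \<mu> q" and nil: "((b - of_complex \<mu>) * q) ^ k = 0"
  shows "\<mu> \<in> poles b"
proof -
  define x where "x = (b - of_complex \<mu>) * q"
  obtain y where q0: "q \<noteq> 0" and sp: "corner_splitting (b - of_complex \<mu>) q y"
    using si unfolding spectral_idempotent_iff_splitting by blast
  interpret corner_splitting "b - of_complex \<mu>" q y by fact
  have xk: "x ^ k = 0" using nil by (simp add: x_def)
  define d where "d n = (if n < 0 then x ^ nat (- n - 1) * q else - (y ^ Suc (nat n)))" for n :: int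
  have "laurent_expansion_at (resolvent b) d \<mu>"
    unfolding laurent_expansion_at_def
  proof (intro exI[of _ "1 / (norm y + 1)"] conjI allI impI)
    show "0 < 1 / (norm y + 1)" by (simp add: add_nonneg_pos)
    fix u assume u: "0 < cmod (u - \<mu>) \<and> cmod (u - \<mu>) < 1 / (norm y + 1)"
    define w where "w = u - \<mu>"
    have w: "w \<noteq> 0" "cmod w * norm y < 1"
      using u cmod_mult_norm_less_1 by (auto simp: w_def)
    define g where "g n = (w powi n) *\<^sub>C d n" for n
    define R where "R = (\<Sum>j<k. (1 / w) ^ j *\<^sub>C x ^ j)"
    have res: "resolvent b u = (1 / w) *\<^sub>C (R * q) - corner_resolvent w"
      using resolvent_shift(1)[OF sp w, of R] nilpotent_pencil_inverse[OF xk, of "1 / w"]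
      by (simp add: w_def R_def x_def)
    have reg: "(g has_sum (- corner_resolvent w)) (range int)"
    proof -
      have "(\<lambda>n. w ^ n *\<^sub>C y ^ Suc n) sums corner_resolvent w"
        unfolding corner_resolvent_def
        using summable_norm_cancel[OF summable_corner_resolvent[OF w(2)]] by (rule summable_sums)
      then have "((\<lambda>n. w ^ n *\<^sub>C y ^ Suc n) has_sum corner_resolvent w) UNIV"
        by (intro norm_summable_imp_has_sum summable_corner_resolvent w)
      then have "((\<lambda>n. - (w ^ n *\<^sub>C y ^ Suc n)) has_sum (- corner_resolvent w)) UNIV"
        by (simp only: has_sum_uminus minus_minus)
      also have "(\<lambda>n. - (w ^ n *\<^sub>C y ^ Suc n)) = g \<circ> int"
        by (auto simp: g_def d_def)
      finally show ?thesis by (simp add: has_sum_reindex o_def)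
    qed
    define h where "h j = - int j - 1" for j
    have sing: "(g has_sum ((1 / w) *\<^sub>C (R * q))) (range h)"
    proof -
      have gh: "g (h j) = (1 / w) ^ Suc j *\<^sub>C (x ^ j * q)" for j
      proof -
        have "w powi h j = (1 / w) ^ Suc j"
          by (simp add: h_def power_int_def nat_add_distrib power_one_over inverse_eq_divide)
        then show ?thesis by (simp add: g_def d_def h_def)
      qed
      have z: "g (h j) = 0" if "j \<notin> {..<k}" for j
      proof -
        have "x ^ j = x ^ k * x ^ (j - k)" using that by (simp flip: power_add)
        then show ?thesis by (simp add: gh xk)
      qed
      have "(1 / w) *\<^sub>C (R * q) = (\<Sum>j<k. (g \<circ> h) j)"
        by (simp add: gh R_def sum_distrib_right mult_scaleC_left scaleC.scale_sum_right
            scaleC_scaleC)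
      then have "((g \<circ> h) has_sum ((1 / w) *\<^sub>C (R * q))) {..<k}"
        by (metis finite_lessThan has_sum_finite)
      then have "((g \<circ> h) has_sum ((1 / w) *\<^sub>C (R * q))) UNIV"
        by (subst has_sum_cong_neutral[where T = "{..<k}" and g = "g \<circ> h"]) (auto simp: z)
      then show ?thesis by (subst has_sum_reindex) (auto simp: h_def inj_on_def)
    qed
    have "(g has_sum ((1 / w) *\<^sub>C (R * q) + - corner_resolvent w)) (range h \<union> range int)"
      by (rule has_sum_Un_disjoint[OF sing reg]) (auto simp: h_def)
    also have "range h \<union> range int = UNIV"
    proof -
      have "n \<in> range h \<union> range int" for n
      proof (cases "n < 0")
        case True
        then have "n = h (nat (- n - 1))" by (simp add: h_def)
        then show ?thesis by blast
      qed (metis UnI2 int_nat_eq linorder_not_less rangeI)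
      then show ?thesis by blast
    qed
    finally show "((\<lambda>n. ((u - \<mu>) powi n) *\<^sub>C d n) has_sum resolvent b u) UNIV"
      by (simp add: g_def[abs_def] w_def[symmetric] res)
  qed
  moreover have "- 1 \<in> {n. n < 0 \<and> d n \<noteq> 0}" using q0 by (simp add: d_def)
  moreover have "{n. n < 0 \<and> d n \<noteq> 0} \<subseteq> {- int k..0}"
  proof
    fix n assume n: "n \<in> {n. n < 0 \<and> d n \<noteq> 0}"
    have "nat (- n - 1) < k"
    proof (rule ccontr)
      assume "\<not> nat (- n - 1) < k"
      then have "x ^ nat (- n - 1) = x ^ k * x ^ (nat (- n - 1) - k)" by (simp flip: power_add)
      moreover have "x ^ nat (- n - 1) * q \<noteq> 0" using n by (auto simp: d_def split: if_splits)
      ultimately show False by (simp add: xk)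
    qed
    then show "n \<in> {- int k..0}" using n by auto
  qed
  ultimately show ?thesis
    unfolding poles_def using spectral_idempotent_imp_isolated[OF si]
    by (blast intro: finite_subset)
qed

section \<open>Block decomposition along an idempotent\<close>

lemma corner_mem_iff:
  fixes e x :: "'a::semigroup_mult"
  assumes "e * e = e"
  shows "x \<in> corner e \<longleftrightarrow> e * x = x \<and> x * e = x"
  unfolding corner_def using assms by (auto simp: mult.assoc) (metis mult.assoc)+

lemma invertible_in_corner_iff_splitting:
  assumes idem: "q * q = q"
    and off: "q * c * (1 - q) = 0" "(1 - q) * c * q = 0"
  shows "invertible_in_corner (1 - q) ((1 - q) * c * (1 - q)) \<longleftrightarrow>
    (\<exists>y. corner_splitting c q y)"
proof -
  let ?e = "1 - q"
  have e: "?e * ?e = ?e" by (simp add: algebra_simps idem)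
  have "q * c = q * c * q" "c * q = q * c * q"
    using off by (simp_all add: left_diff_distrib right_diff_distrib)
  then have comm: "c * q = q * c" by simp
  have ce: "c * ?e = ?e * c" by (simp add: algebra_simps comm)
  have mem: "y \<in> corner ?e \<longleftrightarrow> q * y = 0 \<and> y * q = 0" for y
    unfolding corner_mem_iff[OF e] by (auto simp: algebra_simps)
  have "?e * c * ?e \<in> corner ?e" unfolding corner_def by blast
  moreover have "?e * c * ?e * y = c * y" "y * (?e * c * ?e) = y * c"
    if y: "q * y = 0" "y * q = 0" for y
  proof -
    have ey: "?e * y = y" "y * ?e = y" using y by (simp_all add: algebra_simps)
    have "?e * c * ?e = c * ?e" "?e * c * ?e = ?e * c"
      using ce e by (metis mult.assoc)+
    then show "?e * c * ?e * y = c * y" "y * (?e * c * ?e) = y * c"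
      using ey by (metis mult.assoc)+
  qed
  ultimately show ?thesis
    unfolding invertible_in_corner_def corner_splitting_def using idem comm
    by (auto simp: mem Bex_def)
qed

lemma spectral_idempotent_iff_blocks:
  "spectral_idempotent b \<mu> q \<longleftrightarrow>
     q \<noteq> 0 \<and> idem q \<and>
     q * (b - of_complex \<mu>) * (1 - q) = 0 \<and> (1 - q) * (b - of_complex \<mu>) * q = 0 \<and>
     invertible_in_corner (1 - q) ((1 - q) * (b - of_complex \<mu>) * (1 - q)) \<and>
     quasinilpotent (q * (b - of_complex \<mu>) * q)"
proof -
  define c where "c = b - of_complex \<mu>"
  have off: "q * c * (1 - q) = 0 \<and> (1 - q) * c * q = 0 \<longleftrightarrow> c * q = q * c" if "q * q = q"
  proof
    assume "q * c * (1 - q) = 0 \<and> (1 - q) * c * q = 0"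
    then have "q * c = q * c * q" "c * q = q * c * q"
      by (simp_all add: left_diff_distrib right_diff_distrib)
    then show "c * q = q * c" by simp
  next
    assume "c * q = q * c"
    then have "q * c * q = q * c" "q * c * q = c * q" by (metis mult.assoc that)+
    then show "q * c * (1 - q) = 0 \<and> (1 - q) * c * q = 0"
      by (simp add: left_diff_distrib right_diff_distrib)
  qed
  have diag: "q * c * q = c * q" if "q * q = q" "c * q = q * c"
    by (metis mult.assoc that)
  show ?thesis
    unfolding spectral_idempotent_iff_splitting idem_def c_def[symmetric]
    using off diag invertible_in_corner_iff_splitting[of q c] corner_splitting.idem
      corner_splitting.comm
    by metis
qed

lemma corner_block_eq:
  assumes "spectral_idempotent b \<mu> q"
  shows "q * (b - of_complex \<mu>) * q = (b - of_complex \<mu>) * q"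
proof -
  have "(1 - q) * (b - of_complex \<mu>) * q = 0"
    using assms unfolding spectral_idempotent_iff_blocks by blast
  then show ?thesis by (simp add: left_diff_distrib)
qed

lemma
  assumes "algebra_hom T"
  shows algebra_hom_mult: "T (x * y) = T x * T y"
    and algebra_hom_1: "T 1 = 1"
    and algebra_hom_diff: "T (x - y) = T x - T y"
    and algebra_hom_of_complex: "T (of_complex c) = of_complex c"
    and algebra_hom_power: "T (x ^ n) = T x ^ n"
proof -
  show m: "T (x * y) = T x * T y" and one: "T 1 = 1" for x y
    using assms by (auto simp: algebra_hom_def)
  have "T (x - y) + T y = T (x - y + y)" using assms unfolding algebra_hom_def by metis
  then show "T (x - y) = T x - T y" by (simp add: algebra_simps)
  show "T (of_complex c) = of_complex c"
    using assms by (simp add: algebra_hom_def of_complex_def)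
  show "T (x ^ n) = T x ^ n" by (induction n) (simp_all add: m one)
qed

theorem theorem3p2:
  fixes T :: "'a::complex_banach_algebra_1 \<Rightarrow> 'b::complex_banach_algebra_1"
    and \<mu> :: complex and a :: 'a and b :: 'b
  assumes "algebra_hom T" and "T a = b"
  shows
    "(\<forall>p q p' q'.
        idem p \<and> p \<notin> hom_ker T \<and> q = T p \<and> p' = 1 - p \<and> q' = 1 - q \<and>
        p * (a - of_complex \<mu>) * p' \<in> hom_ker T \<and>
        p' * (a - of_complex \<mu>) * p \<in> hom_ker T \<and>
        p' * (a - of_complex \<mu>) * p' \<in> fredholm_corner T p' q' \<longrightarrow>
        (p * (a - of_complex \<mu>) * p \<in> riesz_elts T \<longrightarrow>
           \<mu> \<in> iso_spectrum b \<and> spectral_idempotent b \<mu> q) \<and>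
        (p * (a - of_complex \<mu>) * p \<in> nilpotent_elts T \<longrightarrow>
           \<mu> \<in> poles b \<and> spectral_idempotent b \<mu> q) \<and>
        (p * (a - of_complex \<mu>) * p \<in> riesz_elts T - nilpotent_elts T \<longrightarrow>
           \<mu> \<in> nonpoles b \<and> spectral_idempotent b \<mu> q)) \<and>
     (\<forall>p q p' q'.
        spectral_idempotent b \<mu> q \<and> idem p \<and> T p = q \<and> p' = 1 - p \<and> q' = 1 - q \<longrightarrow>
        (\<mu> \<in> iso_spectrum b \<longrightarrow>
           p \<notin> hom_ker T \<and>
           p * (a - of_complex \<mu>) * p' \<in> hom_ker T \<and>
           p' * (a - of_complex \<mu>) * p \<in> hom_ker T \<and>
           p' * (a - of_complex \<mu>) * p' \<in> fredholm_corner T p' q' \<and>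
           p * (a - of_complex \<mu>) * p \<in> riesz_elts T) \<and>
        (\<mu> \<in> poles b \<longrightarrow>
           p \<notin> hom_ker T \<and>
           p * (a - of_complex \<mu>) * p' \<in> hom_ker T \<and>
           p' * (a - of_complex \<mu>) * p \<in> hom_ker T \<and>
           p' * (a - of_complex \<mu>) * p' \<in> fredholm_corner T p' q' \<and>
           p * (a - of_complex \<mu>) * p \<in> nilpotent_elts T) \<and>
        (\<mu> \<in> nonpoles b \<longrightarrow>
           p \<notin> hom_ker T \<and>
           p * (a - of_complex \<mu>) * p' \<in> hom_ker T \<and>
           p' * (a - of_complex \<mu>) * p \<in> hom_ker T \<and>
           p' * (a - of_complex \<mu>) * p' \<in> fredholm_corner T p' q' \<and>
           p * (a - of_complex \<mu>) * p \<in> riesz_elts T - nilpotent_elts T))"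
proof -
  note hom = algebra_hom_mult[OF assms(1)] algebra_hom_1[OF assms(1)] algebra_hom_diff[OF assms(1)]
    algebra_hom_of_complex[OF assms(1)] algebra_hom_power[OF assms(1)]
  have fred: "(1 - p) * (a - of_complex \<mu>) * (1 - p) \<in> fredholm_corner T (1 - p) (1 - T p) \<longleftrightarrow>
      invertible_in_corner (1 - T p) ((1 - T p) * (b - of_complex \<mu>) * (1 - T p))" for p
    unfolding fredholm_corner_def corner_def by (auto simp: hom assms(2))
  have pole: "\<mu> \<in> poles b \<longleftrightarrow> (\<exists>k\<ge>1. (q * (b - of_complex \<mu>) * q) ^ k = 0)"
    if "spectral_idempotent b \<mu> q" for q
    unfolding corner_block_eq[OF that]
    using pole_imp_nilpotent[OF that] nilpotent_imp_pole[OF that] by metis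
  have iso: "\<mu> \<in> iso_spectrum b" if "spectral_idempotent b \<mu> q" for q
    using spectral_idempotent_imp_isolated[OF that] .
  have npole: "\<mu> \<in> nonpoles b \<longleftrightarrow> \<not> (\<exists>k\<ge>1. (q * (b - of_complex \<mu>) * q) ^ k = 0)"
    if "spectral_idempotent b \<mu> q" for q
    unfolding nonpoles_def using pole[OF that] iso[OF that] by blast
  have idem_T: "idem (T p)" if "idem p" for p
    using that by (simp add: idem_def flip: hom)
  have key: "spectral_idempotent b \<mu> (T p) \<and> p * (a - of_complex \<mu>) * p \<in> riesz_elts T \<longleftrightarrow>
      p \<notin> hom_ker T \<and>
      p * (a - of_complex \<mu>) * (1 - p) \<in> hom_ker T \<and>
      (1 - p) * (a - of_complex \<mu>) * p \<in> hom_ker T \<and>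
      (1 - p) * (a - of_complex \<mu>) * (1 - p) \<in> fredholm_corner T (1 - p) (1 - T p) \<and>
      p * (a - of_complex \<mu>) * p \<in> riesz_elts T" if "idem p" for p
    unfolding fred spectral_idempotent_iff_blocks hom_ker_def riesz_elts_def
    using idem_T[OF that] by (auto simp: hom assms(2))
  have key': "p * (a - of_complex \<mu>) * p \<in> riesz_elts T" if "spectral_idempotent b \<mu> (T p)" for p
    using that unfolding spectral_idempotent_iff_blocks riesz_elts_def by (simp add: hom assms(2))
  have nilT: "p * (a - of_complex \<mu>) * p \<in> nilpotent_elts T \<longleftrightarrow>
      (\<exists>k\<ge>1. (T p * (b - of_complex \<mu>) * T p) ^ k = 0)" for p
    by (simp add: nilpotent_elts_def hom_ker_def hom assms(2))
  have nilR: "p * (a - of_complex \<mu>) * p \<in> riesz_elts T"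
    if "p * (a - of_complex \<mu>) * p \<in> nilpotent_elts T" for p
    using that nilpotent_imp_quasinilpotent unfolding nilT riesz_elts_def by (auto simp: hom assms(2))
  show ?thesis
  proof (intro conjI allI, goal_cases)
    case (1 p q p' q')
    show ?case
      using key[of p] nilR[of p] iso[of q] pole[of q] npole[of q] nilT[of p] by blast
  next
    case (2 p q p' q')
    show ?case
      using key[of p] key'[of p] pole[of q] npole[of q] nilT[of p] by blast
  qed
qed

end
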